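(* The pair $(\mathbb{Q}\rtimes\mathbb{Q}^{*}_{+},\ \mathrm{P}\rtimes\mathbb{N}^{\times})$ is not a quasi-lattice ordered group.
   Context: $\mathbb{Q}\rtimes\mathbb{Q}^{*}_{+}$ is the semidirect product of the additive rationals by the multiplicative positive rationals, with $(r,x)(s,y)=(r+xs,xy)$ and $(r,x)^{-1}=(-x^{-1}r,x^{-1})$. $\mathrm{P}=\{0,2,3,4,\dots\}$, $\mathbb{N}^{\times}$ is the set of positive integers, and $\mathrm{P}\rtimes\mathbb{N}^{\times}=\{(m,a): m\in\mathrm{P},a\in\mathbb{N}^\times\}$ is a subsemigroup of $\mathbb{Q}\rtimes\mathbb{Q}^{*}_{+}$ with $(\mathrm{P}\rtimes\mathbb{N}^{\times})\cap(\mathrm{P}\rtimes\mathbb{N}^{\times})^{-1}=\{(0,1)\}$. It induces the left-invariant partial order $(r,x)\le(s,y)\iff (r,x)^{-1}(s,y)\in\mathrm{P}\rtimes\mathbb{N}^{\times}$, i.e. $x^{-1}(s-r)\in\mathrm{P}$ and $x^{-1}y\in\mathbb{N}^{\times}$. A pair $(G,M)$, with $G$ a group and $M$ a subsemigroup with $M\cap M^{-1}=\{e\}$, is a quasi-lattice ordered group (Nica) if, for the order $x\le y\iff x^{-1}y\in M$, every finite set of elements of $G$ having a common upper bound in $M$ has a least common upper bound in $M$. In particular, in a quasi-lattice ordered group any two elements of $M$ with a common upper bound in $M$ have a least common upper bound in $M$. *)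

theory Defs
  imports "HOL-Algebra.Algebra"
begin

definition left_order :: "('a, 'b) monoid_scheme \<Rightarrow> 'a set \<Rightarrow> 'a gorder"
  where "left_order G M =
    \<lparr>carrier = carrier G, eq = (=), le = (\<lambda>x y. inv\<^bsub>G\<^esub> x \<otimes>\<^bsub>G\<^esub> y \<in> M)\<rparr>"

locale group_with_subsemigroup = group G for G (structure) +
  fixes M :: "'a set"
  assumes subset_carrier: "M \<subseteq> carrier G"
    and mult_closed: "\<lbrakk>x \<in> M; y \<in> M\<rbrakk> \<Longrightarrow> x \<otimes> y \<in> M"
    and Int_inverse: "M \<inter> set_inv M = {\<one>}"

text \<open>Upper bounds, and the least one among them, are taken in \<open>M\<close>; the elements being
  bounded are arbitrary elements of the group.\<close>

locale quasi_lattice_ordered_group = group_with_subsemigroup +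
  assumes ex_least_upper_bound:
    "\<lbrakk>finite F; F \<subseteq> carrier G; Upper (left_order G M) F \<inter> M \<noteq> {}\<rbrakk>
      \<Longrightarrow> \<exists>u. least (left_order G M) u (Upper (left_order G M) F \<inter> M)"

definition rat_affine :: "(rat \<times> rat) monoid"
  where "rat_affine =
    \<lparr>carrier = UNIV \<times> {0<..}, monoid.mult = (\<lambda>(r, x) (s, y). (r + x * s, x * y)), one = (0, 1)\<rparr>"

definition P_set :: "rat set"
  where "P_set = of_nat ` (UNIV - {1})"

definition pos_nats :: "rat set"
  where "pos_nats = of_nat ` {1..}"

definition P_affine :: "(rat \<times> rat) set"
  where "P_affine = P_set \<times> pos_nats"

lemma group_rat_affine: "group rat_affine"
proof (rule groupI)
  fix p assume "p \<in> carrier rat_affine"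
  then obtain r x where "p = (r, x)" "x > 0" by (auto simp: rat_affine_def)
  then show "\<exists>q\<in>carrier rat_affine. q \<otimes>\<^bsub>rat_affine\<^esub> p = \<one>\<^bsub>rat_affine\<^esub>"
    by (intro bexI[of _ "(- inverse x * r, inverse x)"]) (auto simp: rat_affine_def)
qed (auto simp: rat_affine_def algebra_simps)

lemma inv_rat_affine:
  assumes "x > 0"
  shows "inv\<^bsub>rat_affine\<^esub> (r, x) = (- inverse x * r, inverse x)"
  by (rule group.inv_equality[OF group_rat_affine])
    (use assms in \<open>auto simp: rat_affine_def\<close>)

lemma le_left_order_rat_affine:
  assumes "x > 0"
  shows "(r, x) \<sqsubseteq>\<^bsub>left_order rat_affine P_affine\<^esub> (s, y) \<longleftrightarrow>
    inverse x * (s - r) \<in> P_set \<and> inverse x * y \<in> pos_nats"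
  using assms
  by (simp add: left_order_def inv_rat_affine) (simp add: rat_affine_def P_affine_def algebra_simps)

lemma P_affine_mult_closed:
  assumes "p \<in> P_affine" "q \<in> P_affine"
  shows "p \<otimes>\<^bsub>rat_affine\<^esub> q \<in> P_affine"
proof -
  obtain m a where p: "p = (of_nat m, of_nat a)" "m \<noteq> 1" "a \<ge> 1"
    using assms(1) by (auto simp: P_affine_def P_set_def pos_nats_def)
  obtain n b where q: "q = (of_nat n, of_nat b)" "n \<noteq> 1" "b \<ge> 1"
    using assms(2) by (auto simp: P_affine_def P_set_def pos_nats_def)
  have eq: "p \<otimes>\<^bsub>rat_affine\<^esub> q = (of_nat (m + a * n), of_nat (a * b))"
    by (simp add: p q rat_affine_def)
  have "m + a * n \<noteq> 1"
    using p(2) q(2) by (auto simp: add_is_1)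
  moreover have "a * b \<ge> 1"
    using p(3) q(3) by simp
  ultimately show ?thesis
    unfolding eq P_affine_def P_set_def pos_nats_def by blast
qed

lemma P_affine_Int_inverse: "P_affine \<inter> set_inv\<^bsub>rat_affine\<^esub> P_affine = {(0, 1)}"
proof (intro equalityI subsetI)
  fix p assume "p \<in> P_affine \<inter> set_inv\<^bsub>rat_affine\<^esub> P_affine"
  then obtain q where pq: "p \<in> P_affine" "q \<in> P_affine" "p = inv\<^bsub>rat_affine\<^esub> q"
    by (auto simp: SET_INV_def)
  obtain m a where p: "p = (of_nat m, of_nat a)" "a \<ge> 1"
    using pq(1) by (auto simp: P_affine_def P_set_def pos_nats_def)
  obtain n b where q: "q = (of_nat n, of_nat b)" "b \<ge> 1"
    using pq(2) by (auto simp: P_affine_def P_set_def pos_nats_def)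
  have inv: "inv\<^bsub>rat_affine\<^esub> q = (- inverse (of_nat b) * of_nat n, inverse (of_nat b))"
    unfolding q(1) by (rule inv_rat_affine) (use q(2) in simp)
  have "(of_nat a :: rat) * of_nat b = 1" "(of_nat m :: rat) * of_nat b + of_nat n = 0"
    using pq(3) q(2) unfolding inv p(1) by (auto simp: field_simps)
  then have "of_nat (a * b) = (of_nat 1 :: rat)" "of_nat (m * b + n) = (of_nat 0 :: rat)"
    by simp_all
  then have "a * b = 1" "m * b + n = 0"
    unfolding of_nat_eq_iff by blast+
  then show "p \<in> {(0, 1)}"
    using q(2) by (auto simp: p(1))
next
  fix p :: "rat \<times> rat" assume "p \<in> {(0, 1)}"
  moreover have "(0, 1) \<in> P_affine"
    unfolding P_affine_def P_set_def pos_nats_def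
    by (auto intro!: image_eqI[of _ _ 0] image_eqI[of _ _ 1])
  ultimately show "p \<in> P_affine \<inter> set_inv\<^bsub>rat_affine\<^esub> P_affine"
    by (auto simp: SET_INV_def inv_rat_affine intro!: bexI[of _ "(0, 1)"])
qed

lemma group_with_subsemigroup_rat_affine: "group_with_subsemigroup rat_affine P_affine"
proof (intro group_with_subsemigroup.intro group_with_subsemigroup_axioms.intro group_rat_affine)
  show "P_affine \<subseteq> carrier rat_affine"
    by (auto simp: P_affine_def P_set_def pos_nats_def rat_affine_def)
  show "P_affine \<inter> set_inv\<^bsub>rat_affine\<^esub> P_affine = {\<one>\<^bsub>rat_affine\<^esub>}"
    using P_affine_Int_inverse by (simp add: rat_affine_def)
qed (rule P_affine_mult_closed)

end

theory Submission
  imports Defs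
begin

text \<open>
  The obstruction already lives in the additive part, and comes from the gap at \<open>1\<close> in
  \<open>P = {0, 2, 3, \<dots>}\<close>. For \<open>(2, 1)\<close> and \<open>(3, 1)\<close> to lie below \<open>(s, y)\<close>, both \<open>s - 2\<close>
  and \<open>s - 3\<close> must be in \<open>P\<close>, which forces \<open>s \<ge> 5\<close>: the candidate \<open>s = 3\<close> fails
  because \<open>1 \<notin> P\<close>. Hence \<open>(5, 1)\<close> and \<open>(6, 1)\<close> are upper bounds, and a least one would have to be
  \<open>(5, 1)\<close>. But \<open>(5, 1)\<close> is not below \<open>(6, 1)\<close>, again because \<open>1 \<notin> P\<close>. The two elements bounded lie
  in the subsemigroup itself, so the failure does not depend on admitting elements of the whole group.
\<close>

lemma P_set_cases:
  assumes "q \<in> P_set"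
  shows "q = 0 \<or> q \<ge> 2"
proof -
  obtain n where n: "q = of_nat n" "n \<noteq> 1"
    using assms by (auto simp: P_set_def)
  show ?thesis
  proof (cases "n = 0")
    case False
    with n(2) have "2 \<le> n" by simp
    then have "(of_nat 2 :: rat) \<le> of_nat n" by (simp only: of_nat_le_iff)
    then show ?thesis by (simp add: n(1))
  qed (simp add: n(1))
qed

lemma one_notin_P_set: "1 \<notin> P_set"
  using P_set_cases by fastforce

lemma of_nat_in_P_set: "n \<noteq> 1 \<Longrightarrow> of_nat n \<in> P_set"
  by (auto simp: P_set_def)

lemma numeral_in_P_set: "numeral k \<noteq> (1 :: nat) \<Longrightarrow> numeral k \<in> P_set"
  using of_nat_in_P_set[of "numeral k"] by simp

lemma one_in_pos_nats: "1 \<in> pos_nats"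
  unfolding pos_nats_def by (rule image_eqI[of _ _ 1]) auto

lemma pos_nats_ge_1: "y \<in> pos_nats \<Longrightarrow> y \<ge> 1"
  by (auto simp: pos_nats_def)

lemma pos_nats_inverse_eq_1:
  assumes "y \<in> pos_nats" "inverse y \<in> pos_nats"
  shows "y = 1"
  using pos_nats_ge_1[OF assms(1)] pos_nats_ge_1[OF assms(2)]
  by (simp add: field_simps)

lemma Upper_two_three_iff:
  "(s, y) \<in> Upper (left_order rat_affine P_affine) {(2, 1), (3, 1)} \<inter> P_affine \<longleftrightarrow>
    s \<in> P_set \<and> s - 2 \<in> P_set \<and> s - 3 \<in> P_set \<and> y \<in> pos_nats"
proof -
  have "(2, 1) \<in> carrier (left_order rat_affine P_affine)"
       "(3, 1) \<in> carrier (left_order rat_affine P_affine)"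
    by (simp_all add: left_order_def rat_affine_def)
  moreover have "y \<in> pos_nats \<Longrightarrow> (s, y) \<in> carrier (left_order rat_affine P_affine)"
    using pos_nats_ge_1[of y] by (simp add: left_order_def rat_affine_def)
  moreover have "(s, y) \<in> P_affine \<longleftrightarrow> s \<in> P_set \<and> y \<in> pos_nats"
    by (simp add: P_affine_def)
  ultimately show ?thesis
    by (auto simp: Upper_def le_left_order_rat_affine)
qed

theorem mainTheorem5:
  shows "\<not> quasi_lattice_ordered_group rat_affine P_affine"
proof
  let ?L = "left_order rat_affine P_affine"
  let ?U = "Upper ?L {(2, 1), (3, 1)} \<inter> P_affine"
  assume "quasi_lattice_ordered_group rat_affine P_affine"
  then interpret quasi_lattice_ordered_group rat_affine P_affine .
  have five: "(5, 1) \<in> ?U" and six: "(6, 1) \<in> ?U"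
    unfolding Upper_two_three_iff by (simp_all add: numeral_in_P_set one_in_pos_nats)
  have "{(2, 1), (3, 1)} \<subseteq> carrier rat_affine"
    by (simp add: rat_affine_def)
  then obtain u where u: "least ?L u ?U"
    using ex_least_upper_bound[of "{(2, 1), (3, 1)}"] five by blast
  obtain s y where sy: "u = (s, y)" by fastforce
  have "(s, y) \<in> ?U" and le_five: "(s, y) \<sqsubseteq>\<^bsub>?L\<^esub> (5, 1)" and le_six: "(s, y) \<sqsubseteq>\<^bsub>?L\<^esub> (6, 1)"
    using u five six unfolding least_def sy by blast+
  then have s: "s - 2 \<in> P_set" "s - 3 \<in> P_set" and y: "y \<in> pos_nats"
    unfolding Upper_two_three_iff by auto
  have "y > 0" using pos_nats_ge_1[OF y] by simp
  note le = le_left_order_rat_affine[OF this]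
  have "y = 1"
    using le_five y by (auto simp: le intro: pos_nats_inverse_eq_1)
  then have s': "5 - s \<in> P_set" "6 - s \<in> P_set"
    using le_five le_six unfolding le by simp_all
  have "s \<noteq> 3" using s(1) one_notin_P_set by auto
  then have "s \<ge> 5" using P_set_cases[OF s(2)] by auto
  then have "s = 5" using P_set_cases[OF s'(1)] by auto
  then show False using s'(2) one_notin_P_set by simp
qed

end
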